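(* There is an absolute constant $A$ such that the following holds. Consider any coordination game (without bonuses) on an unweighted open chain of cycles consisting of $m\geq 2$ simple cycles with $n\ge 3$ nodes each. Then from every initial joint strategy there starts a finite c-improvement path of length at most $A\,n m^3$, i.e. the game has a c-improvement path of length $\mathcal{O}(nm^3)$.
   Context: Coordination game (unweighted, without bonuses): let $M$ be a finite set of colours and $G=(V,E)$ a finite directed graph without self-loops. The set of neighbours of $i$ is $N_i=\{j\in V : (j\to i)\in E\}$. A colour assignment $C$ gives each node $i$ a non-empty set $C(i)\subseteq M$. The players are the nodes; the strategy set of player $i$ is $C(i)$; the payoff of $i$ in a joint strategy $s=(s_j)_{j\in V}$ is $p_i(s)=|\{j\in N_i : s_j=s_i\}|$. Open chain of cycles: let $m\ge2$, $n\geq 3$, and for $j\in\{1,\dots,m\}$ let $\mathcal{C}_j$ be the directed cycle $1^j\to 2^j\to\cdots\to n^j\to 1^j$. An open chain of cycles is the directed graph that is the union of $\mathcal{C}_1,\dots,\mathcal{C}_m$ where, for each $j\in\{1,\dots,m-1\}$, the node $1^j$ is identified with the node $k_j^{\,j+1}$ of $\mathcal{C}_{j+1}$ for some $k_j\in\{2,\dots,n\}$, and there are no other identifications. A coalition is a non-empty set of players. A joint strategy $s'$ is a profitable deviation of coalition $K$ from $s$ if $K=\{i : s_i\neq s'_i\}$ and $p_i(s')>p_i(s)$ for all $i\in K$. A c-improvement path is a maximal (i.e. non-extendable) sequence of joint strategies in which each element after the first is a profitable deviation of some coalition from the previous element. A finite c-improvement path ends in a strong equilibrium (a joint strategy from which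 no coalition has a profitable deviation). The length of a finite path is the number of its elements. *)

theory Defs
  imports "Graph_Theory.Pair_Digraph" "HOL-Library.FuncSet"
begin

locale coordination_game = pair_digraph G
  for G :: "'v pair_pre_digraph" +
  fixes M :: "'c set" and C :: "'v \<Rightarrow> 'c set"
  assumes finite_colours: "finite M"
    and colours_nonempty: "i \<in> pverts G \<Longrightarrow> C i \<noteq> {}"
    and colours_subset: "i \<in> pverts G \<Longrightarrow> C i \<subseteq> M"
begin

definition neighbours :: "'v \<Rightarrow> 'v set" where
  "neighbours i = {j \<in> pverts G. (j, i) \<in> parcs G}"

text \<open>The extensional function space makes equality of joint strategies coincide with
  agreement on all players.\<close>

definition joint_strategies :: "('v \<Rightarrow> 'c) set" where
  "joint_strategies = (\<Pi>\<^sub>E i\<in>pverts G. C i)"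

definition payoff :: "('v \<Rightarrow> 'c) \<Rightarrow> 'v \<Rightarrow> nat" where
  "payoff s i = card {j \<in> neighbours i. s j = s i}"

definition coalition :: "'v set \<Rightarrow> bool" where
  "coalition K \<longleftrightarrow> K \<noteq> {} \<and> K \<subseteq> pverts G"

definition profitable_deviation :: "'v set \<Rightarrow> ('v \<Rightarrow> 'c) \<Rightarrow> ('v \<Rightarrow> 'c) \<Rightarrow> bool" where
  "profitable_deviation K s s' \<longleftrightarrow>
     coalition K \<and> s \<in> joint_strategies \<and> s' \<in> joint_strategies \<and>
     K = {i \<in> pverts G. s i \<noteq> s' i} \<and> (\<forall>i\<in>K. payoff s' i > payoff s i)"

definition improvement_step :: "('v \<Rightarrow> 'c) \<Rightarrow> ('v \<Rightarrow> 'c) \<Rightarrow> bool" where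
  "improvement_step s s' \<longleftrightarrow> (\<exists>K. profitable_deviation K s s')"

definition improvement_sequence :: "('v \<Rightarrow> 'c) list \<Rightarrow> bool" where
  "improvement_sequence p \<longleftrightarrow>
     p \<noteq> [] \<and> set p \<subseteq> joint_strategies \<and> successively improvement_step p"

text \<open>The list represents a finite path, the last conjunct being its maximality.\<close>

definition finite_c_improvement_path :: "('v \<Rightarrow> 'c) list \<Rightarrow> bool" where
  "finite_c_improvement_path p \<longleftrightarrow>
     improvement_sequence p \<and> \<not> (\<exists>s'. improvement_sequence (p @ [s']))"

end

text \<open>The pair \<open>(j, i)\<close> stands for the node $i^j$, that is, the \<open>i\<close>-th node of the
  \<open>j\<close>-th cycle, before identification.\<close>

definition chain_labels :: "nat \<Rightarrow> nat \<Rightarrow> (nat \<times> nat) set" where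
  "chain_labels m n = {1..m} \<times> {1..n}"

definition chain_identifications :: "nat \<Rightarrow> (nat \<Rightarrow> nat) \<Rightarrow> (nat \<times> nat) rel" where
  "chain_identifications m k = {((j, 1), (j + 1, k j)) | j. j \<in> {1..m - 1}}"

text \<open>The map \<open>node\<close> sends each label to a vertex of \<open>G\<close>; two labels name the same vertex
  exactly if they are related by the equivalence relation generated by the prescribed
  identifications. Since \<open>node\<close> is arbitrary otherwise, the notion is invariant under
  graph isomorphism. The successor of \<open>i\<close> on a cycle is \<open>i mod n + 1\<close>.\<close>

definition open_chain_of_cycles :: "nat \<Rightarrow> nat \<Rightarrow> 'v pair_pre_digraph \<Rightarrow> bool" where
  "open_chain_of_cycles m n G \<longleftrightarrow>
     (\<exists>(k :: nat \<Rightarrow> nat) (node :: nat \<times> nat \<Rightarrow> 'v).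
        (\<forall>j\<in>{1..m - 1}. k j \<in> {2..n}) \<and>
        pverts G = node ` chain_labels m n \<and>
        parcs G = {(node (j, i), node (j, i mod n + 1)) | j i. (j, i) \<in> chain_labels m n} \<and>
        (\<forall>x\<in>chain_labels m n. \<forall>y\<in>chain_labels m n.
           node x = node y \<longleftrightarrow>
           (x, y) \<in> (chain_identifications m k \<union> (chain_identifications m k)\<inverse>)\<^sup>*))"

end

theory Submission
  imports Defs
begin

text \<open>A monochromatic cycle is frozen, so the number of monochromatic cycles never decreases,
  and it strictly increases whenever a coalition deviates from a Nash equilibrium. Hence it
  suffices to reach a Nash equilibrium or a new monochromatic cycle within \<open>O(n m\<^sup>2)\<close> steps by
  single players. If every link \<open>1\<^sup>q\<close> ignores its lower predecessor \<open>n\<^sup>q\<close>, the graph becomes a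
  tree with root \<open>1\<^sup>m\<close>, and sweeping this tree from the root makes all nodes stable in one pass.
  A link adopts the colour of \<open>n\<^sup>q\<close> whenever that is possible and profitable, and then it only
  moves again after \<open>n\<^sup>q\<close> has changed. A colour that runs from \<open>1\<^sup>q\<close> all the way to \<open>n\<^sup>q\<close> makes
  the cycle monochromatic; otherwise a change of \<open>n\<^sup>q\<close> is caused by the link \<open>1\<^bsup>q-1\<^esup>\<close> adopting
  its lower colour, or by initial disorder. So the sources of disturbance travel upwards
  along the chain, at most \<open>O(m\<^sup>2)\<close> times altogether, and each of their moves costs \<open>O(n)\<close>
  amortised steps.\<close>

locale open_chain = coordination_game G M C
  for G :: "'v pair_pre_digraph" and M :: "'c set" and C :: "'v \<Rightarrow> 'c set" +
  fixes m n :: nat and k :: "nat \<Rightarrow> nat" and node :: "nat \<times> nat \<Rightarrow> 'v"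
  assumes m_ge: "2 \<le> m" and n_ge: "3 \<le> n"
    and k_range: "\<forall>j\<in>{1..m - 1}. k j \<in> {2..n}"
    and pverts_eq: "pverts G = node ` chain_labels m n"
    and parcs_eq: "parcs G = {(node (j, i), node (j, i mod n + 1)) | j i. (j, i) \<in> chain_labels m n}"
    and node_rtrancl: "\<forall>x\<in>chain_labels m n. \<forall>y\<in>chain_labels m n.
      node x = node y \<longleftrightarrow> (x, y) \<in> (chain_identifications m k \<union> (chain_identifications m k)\<inverse>)\<^sup>*"
begin

section \<open>Labels, identifications and predecessors\<close>

definition lab :: "nat \<Rightarrow> nat \<Rightarrow> bool" where
  "lab j i \<longleftrightarrow> 1 \<le> j \<and> j \<le> m \<and> 1 \<le> i \<and> i \<le> n"

text \<open>The position on the \<open>q\<close>-th cycle of its link to the previous cycle; the value \<open>0\<close> means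
  that there is none.\<close>

definition lk :: "nat \<Rightarrow> nat" where
  "lk q = (if 2 \<le> q then k (q - 1) else 0)"

lemma k_bounds:
  assumes "1 \<le> j" "j < m"
  shows "2 \<le> k j" "k j \<le> n"
  using k_range[rule_format, of j] assms by auto

lemma lk_Suc: "1 \<le> l \<Longrightarrow> lk (Suc l) = k l"
  by (simp add: lk_def)

lemma lab_chain_labels: "(j, i) \<in> chain_labels m n \<longleftrightarrow> lab j i"
  by (auto simp: chain_labels_def lab_def)

lemma chain_identifications_iff:
  "((j, i), (j', i')) \<in> chain_identifications m k \<longleftrightarrow>
    1 \<le> j \<and> j < m \<and> i = 1 \<and> j' = Suc j \<and> i' = k j"
  using m_ge by (auto simp: chain_identifications_def)

text \<open>An identification pairs position \<open>1\<close> with a position at least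
  \<open>2\<close>, so two steps in the same direction never compose, and two in opposite directions
  cancel.\<close>

lemma identifications_rtrancl:
  assumes "(x, y) \<in> (chain_identifications m k \<union> (chain_identifications m k)\<inverse>)\<^sup>*"
  shows "x = y \<or> (x, y) \<in> chain_identifications m k \<or> (y, x) \<in> chain_identifications m k"
  using assms
proof (induction rule: rtrancl_induct)
  case (step y z)
  obtain a b where x: "x = (a, b)" by (cases x)
  obtain c d where y: "y = (c, d)" by (cases y)
  obtain e f where z: "z = (e, f)" by (cases z)
  have "1 \<le> j \<and> j < m \<longrightarrow> 2 \<le> k j" for j
    using k_bounds(1) by blast
  then have "2 \<le> d \<or> \<not> (1 \<le> c \<and> c < m \<and> d = k c)" "2 \<le> d \<or> \<not> (1 \<le> a \<and> a < m \<and> d = k a)"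
    "2 \<le> d \<or> \<not> (1 \<le> e \<and> e < m \<and> d = k e)"
    by auto
  with step(2,3) show ?case
    unfolding x y z by (simp add: chain_identifications_iff) (elim disjE conjE; simp)
qed simp

lemma node_eq_iff:
  assumes "lab j i" "lab j' i'"
  shows "node (j, i) = node (j', i') \<longleftrightarrow> (j = j' \<and> i = i') \<or>
    (j' = Suc j \<and> i = 1 \<and> i' = k j) \<or> (j = Suc j' \<and> i' = 1 \<and> i = k j')"
    (is "_ \<longleftrightarrow> ?R")
proof
  assume "node (j, i) = node (j', i')"
  then have "((j, i), (j', i')) \<in> (chain_identifications m k \<union> (chain_identifications m k)\<inverse>)\<^sup>*"
    using node_rtrancl assms lab_chain_labels by blast
  from identifications_rtrancl[OF this] show ?R
    by (auto simp: chain_identifications_def)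
next
  assume R: ?R
  have "(j, i) = (j', i') \<or> ((j, i), (j', i')) \<in> chain_identifications m k
      \<or> ((j', i'), (j, i)) \<in> chain_identifications m k"
    using R assms by (auto simp: chain_identifications_def lab_def)
  then have "((j, i), (j', i')) \<in> (chain_identifications m k \<union> (chain_identifications m k)\<inverse>)\<^sup>*"
    by auto
  then show "node (j, i) = node (j', i')"
    using node_rtrancl assms lab_chain_labels by blast
qed

lemma node_link: "1 \<le> l \<Longrightarrow> l < m \<Longrightarrow> node (l, 1) = node (Suc l, k l)"
  using node_eq_iff[of l 1 "Suc l" "k l"] k_bounds[of l] n_ge by (simp add: lab_def)

lemma pverts_lab: "v \<in> pverts G \<longleftrightarrow> (\<exists>j i. lab j i \<and> v = node (j, i))"
  unfolding pverts_eq image_iff by (metis lab_chain_labels surj_pair)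

text \<open>Position \<open>1\<close> of every cycle but the last coincides with a position at least
  \<open>2\<close> of the next cycle. Predecessors can thus be given by one formula and one
  exception.\<close>

lemma node_cases:
  assumes "v \<in> pverts G"
  obtains q i where "lab q i" "2 \<le> i" "v = node (q, i)" | "v = node (m, 1)"
proof -
  obtain j i where ji: "lab j i" "v = node (j, i)"
    using assms pverts_lab by blast
  show thesis
  proof (cases "2 \<le> i")
    case True
    with ji that show ?thesis by blast
  next
    case False
    with ji have [simp]: "i = 1" by (simp add: lab_def)
    show ?thesis
    proof (cases "j = m")
      case True
      with ji that show ?thesis by simp
    next
      case False
      with ji have "1 \<le> j" "j < m" by (auto simp: lab_def)
      then have "lab (Suc j) (k j)" "2 \<le> k j" "v = node (Suc j, k j)"
        using ji k_bounds[of j] node_link by (auto simp: lab_def)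
      with that show ?thesis by blast
    qed
  qed
qed

lemma neighbours_iff:
  "x \<in> neighbours v \<longleftrightarrow> (\<exists>j i. lab j i \<and> x = node (j, i) \<and> v = node (j, i mod n + 1))"
  unfolding neighbours_def parcs_eq using pverts_lab by (auto simp: lab_chain_labels)

lemma neighbours_node:
  assumes "lab q i" "2 \<le> i"
  shows "neighbours (node (q, i)) =
    insert (node (q, i - 1)) (if i = lk q then {node (q - 1, n)} else {})" (is "_ = ?R")
proof (intro set_eqI iffI)
  fix x assume "x \<in> neighbours (node (q, i))"
  then obtain j i' where *: "lab j i'" "x = node (j, i')" "node (q, i) = node (j, i' mod n + 1)"
    unfolding neighbours_iff by blast
  then have "lab j (i' mod n + 1)"
    using n_ge by (auto simp: lab_def Suc_le_eq)
  with * assms have "(q = j \<and> i = i' mod n + 1) \<or> (q = Suc j \<and> i' mod n = 0 \<and> i = k j)"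
    by (auto simp: node_eq_iff)
  then show "x \<in> ?R"
  proof
    assume "q = j \<and> i = i' mod n + 1"
    moreover from this have "i' \<noteq> n" using assms by auto
    ultimately show ?thesis using * by (auto simp: lab_def)
  next
    assume h: "q = Suc j \<and> i' mod n = 0 \<and> i = k j"
    then have "i' = n" using * by (auto simp: lab_def simp: mod_if split: if_splits)
    with h * show ?thesis by (auto simp: lab_def lk_def)
  qed
next
  fix x assume "x \<in> ?R"
  then consider "x = node (q, i - 1)" | "i = lk q" "x = node (q - 1, n)"
    by (auto split: if_splits)
  then show "x \<in> neighbours (node (q, i))"
  proof cases
    case 1
    then show ?thesis unfolding neighbours_iff using assms
      by (intro exI[of _ q] exI[of _ "i - 1"]) (auto simp: lab_def)
  next
    case 2
    then have q: "2 \<le> q" using assms by (auto simp: lk_def split: if_splits)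
    with 2 node_link[of "q - 1"] assms have "node (q - 1, 1) = node (q, i)"
      by (auto simp: lab_def lk_def)
    with 2 q assms n_ge show ?thesis unfolding neighbours_iff
      by (intro exI[of _ "q - 1"] exI[of _ n]) (auto simp: lab_def)
  qed
qed

lemma neighbours_node_m: "neighbours (node (m, 1)) = {node (m, n)}"
proof (intro set_eqI iffI)
  fix x assume "x \<in> neighbours (node (m, 1))"
  then obtain j i' where *: "lab j i'" "x = node (j, i')" "node (m, 1) = node (j, i' mod n + 1)"
    unfolding neighbours_iff by blast
  then have "lab j (i' mod n + 1)" "lab m 1"
    using n_ge m_ge by (auto simp: lab_def Suc_le_eq)
  moreover have "k j \<noteq> 1" if "1 \<le> j" "j < m" using k_bounds[OF that] by simp
  ultimately have "j = m" "i' mod n = 0"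
    using * by (auto simp: node_eq_iff lab_def)
  then show "x \<in> {node (m, n)}"
    using * by (auto simp: lab_def simp: mod_if split: if_splits)
next
  fix x assume "x \<in> {node (m, n)}"
  then show "x \<in> neighbours (node (m, 1))"
    unfolding neighbours_iff using m_ge n_ge
    by (intro exI[of _ m] exI[of _ n]) (auto simp: lab_def)
qed

section \<open>Colours, payoffs and moves of single nodes\<close>

definition col :: "('v \<Rightarrow> 'c) \<Rightarrow> nat \<Rightarrow> nat \<Rightarrow> 'c" where
  "col s j i = s (node (j, i))"

lemma col_link: "1 \<le> l \<Longrightarrow> l < m \<Longrightarrow> col s (Suc l) (k l) = col s l 1"
  using node_link[of l] by (simp add: col_def)

lemma col_in: "s \<in> joint_strategies \<Longrightarrow> lab j i \<Longrightarrow> col s j i \<in> C (node (j, i))"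
  unfolding joint_strategies_def col_def using pverts_lab by (blast intro: PiE_mem)

lemma payoff_node:
  assumes "lab q i" "2 \<le> i"
  shows "payoff s (node (q, i)) = of_bool (col s q (i - 1) = col s q i)
    + of_bool (i = lk q \<and> col s (q - 1) n = col s q i)"
proof (cases "i = lk q")
  case True
  then have q: "2 \<le> q" using assms by (auto simp: lk_def split: if_splits)
  have "lab (q - 1) n" "lab q (i - 1)" using assms q n_ge by (auto simp: lab_def)
  \<comment> \<open>The two predecessors of a link are distinct, so the cardinality is the sum of
    the two indicators.\<close>
  then have "node (q - 1, n) \<noteq> node (q, i - 1)"
    using n_ge q by (auto simp: node_eq_iff)
  moreover have "{j \<in> neighbours (node (q, i)). s j = s (node (q, i))} =
    (if col s q (i - 1) = col s q i then {node (q, i - 1)} else {}) \<union>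
    (if col s (q - 1) n = col s q i then {node (q - 1, n)} else {})"
    unfolding neighbours_node[OF assms] col_def using True by auto
  ultimately show ?thesis using True by (auto simp: payoff_def)
next
  case False
  then have "{j \<in> neighbours (node (q, i)). s j = s (node (q, i))} =
    (if col s q (i - 1) = col s q i then {node (q, i - 1)} else {})"
    unfolding neighbours_node[OF assms] col_def by auto
  with False show ?thesis by (auto simp: payoff_def)
qed

text \<open>The payoff of a link as seen from its lower cycle, where it has position
  \<open>1\<close>.\<close>

lemma payoff_first:
  assumes "1 \<le> l" "l \<le> m"
  shows "payoff s (node (l, 1)) = of_bool (col s l n = col s l 1)
    + of_bool (l < m \<and> col s (Suc l) (k l - 1) = col s l 1)"
proof (cases "l < m")
  case True
  then have "lab (Suc l) (k l)" "2 \<le> k l"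
    using k_bounds[of l] assms by (auto simp: lab_def)
  from payoff_node[OF this, of s] True assms show ?thesis
    unfolding node_link[OF assms(1) True] col_link[OF assms(1) True] by (simp add: lk_Suc)
next
  case False
  with assms have "l = m" by simp
  moreover have "{j \<in> neighbours (node (m, 1)). s j = s (node (m, 1))} =
    (if col s m n = col s m 1 then {node (m, n)} else {})"
    unfolding neighbours_node_m col_def by auto
  ultimately show ?thesis by (simp add: payoff_def)
qed

text \<open>A link has two labels, so recolouring it at position \<open>lk q\<close> also shows at
  position \<open>1\<close> of the cycle below.\<close>

lemma col_upd_node:
  assumes "lab q i" "2 \<le> i" "lab r j"
  shows "col (s(node (q, i) := c)) r j =
    (if (r = q \<and> j = i) \<or> (i = lk q \<and> q = Suc r \<and> j = 1) then c else col s r j)"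
  using assms node_eq_iff[of r j q i] by (auto simp: col_def lk_def lab_def)

lemma col_upd_first:
  assumes "1 \<le> l" "l \<le> m" "lab r j"
  shows "col (s(node (l, 1) := c)) r j =
    (if (r = l \<and> j = 1) \<or> (r = Suc l \<and> j = k l) then c else col s r j)"
proof -
  have "lab l 1" using assms n_ge by (auto simp: lab_def)
  moreover have "k r \<noteq> 1" if "l = Suc r" using k_bounds[of r] that assms by (auto simp: lab_def)
  ultimately show ?thesis
    using assms node_eq_iff[of r j l 1] by (auto simp: col_def)
qed

lemma single_step:
  assumes "s \<in> joint_strategies" "v \<in> pverts G" "c \<in> C v" "payoff s v < payoff (s(v := c)) v"
  shows "improvement_step s (s(v := c))"
proof -
  have "s v \<noteq> c" using assms(4) by (metis fun_upd_triv less_irrefl)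
  then have "{i \<in> pverts G. s i \<noteq> (s(v := c)) i} = {v}" using assms(2) by auto
  moreover have "s(v := c) \<in> joint_strategies"
    using assms(1-3) unfolding joint_strategies_def
    by (auto simp: PiE_iff extensional_def)
  ultimately have "profitable_deviation {v} s (s(v := c))"
    using assms by (auto simp: profitable_deviation_def coalition_def)
  then show ?thesis unfolding improvement_step_def by blast
qed

section \<open>Monochromatic cycles and coalition deviations\<close>

definition mono_cycle :: "('v \<Rightarrow> 'c) \<Rightarrow> nat \<Rightarrow> bool" where
  "mono_cycle s q \<longleftrightarrow> (\<forall>i\<in>{1..n}. col s q i = col s q 1)"

text \<open>Induction against the orientation of the cycle, the direction in which deviators are
  traced to their supporters.\<close>

lemma cycle_induct:
  assumes "i0 \<in> {1..n}" "P i0" "P 1 \<Longrightarrow> P n"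
    and "\<And>i. 2 \<le> i \<Longrightarrow> i \<le> n \<Longrightarrow> P i \<Longrightarrow> P (i - 1)"
  shows "\<forall>i\<in>{1..n}. P i"
proof -
  have down: "P b" if "P a" "1 \<le> b" "b \<le> a" "a \<le> n" for a b
    using that(3,1,2,4)
  proof (induction rule: inc_induct)
    case (step c)
    then show ?case using assms(4)[of "Suc c"] by simp
  qed
  have "P 1" using down[of i0 1] assms(1,2) by auto
  then have "P n" by (rule assms(3))
  then show ?thesis using down[of n] by auto
qed

lemma payoff_less_2:
  assumes "lab q i" "col s q (if i = 1 then n else i - 1) \<noteq> col s q i"
  shows "payoff s (node (q, i)) \<le> 1"
proof (cases "i = 1")
  case True
  then show ?thesis using assms payoff_first[of q s] by (auto simp: lab_def)
next
  case False
  with assms have "2 \<le> i" by (auto simp: lab_def)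
  with assms False show ?thesis using payoff_node[of q i s] by simp
qed

lemma payoff_pos:
  assumes "lab q i" "col s q (if i = 1 then n else i - 1) = col s q i"
  shows "payoff s (node (q, i)) \<ge> 1"
proof (cases "i = 1")
  case True
  then show ?thesis using assms payoff_first[of q s] by (auto simp: lab_def)
next
  case False
  with assms have "2 \<le> i" by (auto simp: lab_def)
  with assms False show ?thesis using payoff_node[of q i s] by simp
qed

text \<open>A cycle contains a node of in-degree one. If the cycle is monochromatic, this node already
  has its maximal payoff, and a successor of an unchanged node can only leave the common colour
  by gaining a payoff of at most one, which it has already.\<close>

lemma mono_cycle_frozen:
  assumes dev: "profitable_deviation K s s'" and mono: "mono_cycle s q" and q: "1 \<le> q" "q \<le> m"
  shows "\<forall>i\<in>{1..n}. col s' q i = col s q i"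
proof (rule ccontr)
  assume "\<not> ?thesis"
  then obtain i0 where i0: "i0 \<in> {1..n}" "col s' q i0 \<noteq> col s q i0" by blast
  have gt: "payoff s (node (q, i)) < payoff s' (node (q, i))"
    if "i \<in> {1..n}" "col s' q i \<noteq> col s q i" for i
  proof -
    have "lab q i" using that q by (auto simp: lab_def)
    then have "node (q, i) \<in> pverts G" using pverts_lab by blast
    then have "node (q, i) \<in> K"
      using dev that by (auto simp: profitable_deviation_def col_def)
    with dev show ?thesis by (auto simp: profitable_deviation_def)
  qed
  have step: "col s' q (if i = 1 then n else i - 1) \<noteq> col s q (if i = 1 then n else i - 1)"
    if i: "i \<in> {1..n}" "col s' q i \<noteq> col s q i" for i
  proof
    let ?p = "if i = 1 then n else i - 1"
    assume eq: "col s' q ?p = col s q ?p"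
    have lab: "lab q i" using i q by (auto simp: lab_def)
    have p: "?p \<in> {1..n}" using i n_ge by auto
    then have *: "col s q ?p = col s q i" using mono i unfolding mono_cycle_def by metis
    with eq i have "payoff s' (node (q, i)) \<le> 1" using payoff_less_2[OF lab, of s'] by metis
    moreover have "payoff s (node (q, i)) \<ge> 1" using payoff_pos[OF lab, of s] * by blast
    ultimately show False using gt[OF i] by simp
  qed
  have all: "\<forall>i\<in>{1..n}. col s' q i \<noteq> col s q i"
  proof (rule cycle_induct[where P = "\<lambda>i. col s' q i \<noteq> col s q i", OF i0])
    show "col s' q n \<noteq> col s q n" if "col s' q 1 \<noteq> col s q 1"
      using step[of 1] that n_ge by simp
    show "col s' q (i - 1) \<noteq> col s q (i - 1)" if "2 \<le> i" "i \<le> n" "col s' q i \<noteq> col s q i" for i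
      using step[of i] that by simp
  qed
  \<comment> \<open>A position of in-degree one; the alternative \<open>3\<close> exists because
    \<open>n\<close> is at least \<open>3\<close>.\<close>
  define i1 where "i1 = (if lk q = 2 then 3 else 2 :: nat)"
  have i1: "lab q i1" "2 \<le> i1" "i1 \<in> {1..n}" "i1 \<noteq> lk q"
    using q n_ge by (auto simp: lab_def i1_def)
  then have "payoff s' (node (q, i1)) \<le> 1"
    using payoff_node[of q i1 s'] by simp
  moreover have "i1 - 1 \<in> {1..n}" using i1 by auto
  then have "col s q (i1 - 1) = col s q i1" using mono i1 unfolding mono_cycle_def by metis
  then have "payoff s (node (q, i1)) \<ge> 1" using payoff_node[of q i1 s] i1 by simp
  ultimately show False using gt[OF i1(3)] all i1 by fastforce
qed

lemma mono_cycle_mono: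
  assumes "improvement_step s s'" "mono_cycle s q" "1 \<le> q" "q \<le> m"
  shows "mono_cycle s' q"
proof -
  obtain K where "profitable_deviation K s s'"
    using assms(1) unfolding improvement_step_def by blast
  note frozen = bspec[OF mono_cycle_frozen[OF this assms(2-4)]]
  have "col s' q 1 = col s q 1" using frozen n_ge by simp
  with frozen show ?thesis
    using assms(2) unfolding mono_cycle_def by metis
qed

definition mono_count :: "('v \<Rightarrow> 'c) \<Rightarrow> nat" where
  "mono_count s = card {q \<in> {1..m}. mono_cycle s q}"

lemma mono_count_le: "mono_count s \<le> m"
  using card_mono[of "{1..m}" "{q \<in> {1..m}. mono_cycle s q}"] unfolding mono_count_def by force

lemma mono_count_mono: "improvement_step s s' \<Longrightarrow> mono_count s \<le> mono_count s'"
  unfolding mono_count_def by (intro card_mono) (auto intro: mono_cycle_mono)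

lemma mono_count_less:
  assumes "improvement_step s s'" "1 \<le> q" "q \<le> m" "\<not> mono_cycle s q" "mono_cycle s' q"
  shows "mono_count s < mono_count s'"
  unfolding mono_count_def
  using assms by (intro psubset_card_mono) (auto intro: mono_cycle_mono)

lemma labels_of_node:
  assumes "lab q i" "lab r j" "node (q, i) = node (r, j)"
  shows "(r = q \<and> j = i) \<or> (i = 1 \<and> r = Suc q \<and> j = lk r) \<or> (i = lk q \<and> 2 \<le> q \<and> r = q - 1 \<and> j = 1)"
  using assms by (auto simp: node_eq_iff lk_def lab_def)

text \<open>Tracing the support of the deviating nodes backwards yields a directed cycle of deviators;
  since the underlying graph is a cactus, this must be one of the given cycles. The choice of
  \<open>q\<close> below rules out that the trace leaves the \<open>q\<close>-th cycle at a link.\<close>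

lemma coalition_deviation_mono_cycle:
  assumes dev: "profitable_deviation K s s'"
    and NE: "\<And>v c. v \<in> pverts G \<Longrightarrow> c \<in> C v \<Longrightarrow> payoff (s(v := c)) v \<le> payoff s v"
  obtains q where "1 \<le> q" "q \<le> m" "mono_cycle s' q" "\<not> mono_cycle s q"
proof -
  define p where "p i = (if i = 1 then n else i - 1)" for i
  define supp where "supp q i \<longleftrightarrow> lab q i \<and> node (q, i) \<in> K \<and> node (q, p i) \<in> K
    \<and> col s' q (p i) = col s' q i" for q i
  have K: "K \<noteq> {}" "K \<subseteq> pverts G" "K = {i \<in> pverts G. s i \<noteq> s' i}"
    "\<And>v. v \<in> K \<Longrightarrow> payoff s v < payoff s' v"
    and s: "s \<in> joint_strategies" "s' \<in> joint_strategies"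
    using dev by (auto simp: profitable_deviation_def coalition_def)
  \<comment> \<open>Without a supporting deviator, only unchanged predecessors can match the new
    colour, so changing alone would pay at least as much, contrary to \<open>NE\<close>.\<close>
  have supported: "\<exists>x\<in>neighbours v. x \<in> K \<and> s' x = s' v" if v: "v \<in> K" for v
  proof (rule ccontr)
    assume no: "\<not> ?thesis"
    have "s' v \<in> C v" using s(2) v K(2) by (auto simp: joint_strategies_def)
    then have "payoff (s(v := s' v)) v \<le> payoff s v"
      using NE v K(2) by auto
    moreover have "payoff s' v \<le> payoff (s(v := s' v)) v"
      unfolding payoff_def
    proof (rule card_mono)
      show "finite {j \<in> neighbours v. (s(v := s' v)) j = (s(v := s' v)) v}"
        by (rule finite_subset[of _ "pverts G"]) (auto simp: neighbours_def)
      show "{j \<in> neighbours v. s' j = s' v} \<subseteq> {j \<in> neighbours v. (s(v := s' v)) j = (s(v := s' v)) v}"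
        using no K(3) by (auto simp: neighbours_def)
    qed
    ultimately show False using K(4)[OF v] by simp
  qed
  have supp_ex: "\<exists>r j. supp r j \<and> node (r, j) = v" if v: "v \<in> K" for v
  proof -
    obtain x where x: "x \<in> neighbours v" "x \<in> K" "s' x = s' v" using supported[OF v] by blast
    then obtain j i where ji: "lab j i" "x = node (j, i)" "v = node (j, i mod n + 1)"
      unfolding neighbours_iff by blast
    then have "lab j (i mod n + 1)" "p (i mod n + 1) = i"
      using n_ge by (auto simp: lab_def p_def Suc_le_eq mod_if)
    then have "supp j (i mod n + 1)" using x ji v by (auto simp: supp_def col_def)
    with ji show ?thesis by blast
  qed
  have supp_cases: "supp q i \<or> (i = 1 \<and> supp (Suc q) (lk (Suc q)))
      \<or> (i = lk q \<and> 2 \<le> q \<and> supp (q - 1) 1)"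
    if at: "lab q i" "node (q, i) \<in> K" for q i
  proof -
    obtain r j where rj: "supp r j" "node (q, i) = node (r, j)" using supp_ex[OF at(2)] by metis
    then have "lab r j" by (simp add: supp_def)
    with labels_of_node[OF at(1) this rj(2)] rj(1) show ?thesis by auto
  qed
  have "\<exists>q. (\<exists>i. supp q i) \<and> (\<forall>i. lab q i \<and> node (q, i) \<in> K \<longrightarrow> supp q i)"
  proof (cases "\<exists>q. 2 \<le> q \<and> supp q (lk q)")
    case True
    \<comment> \<open>In the highest cycle that supports its own link to the previous cycle,
      position \<open>1\<close> cannot be supported from the cycle above.\<close>
    define Q where "Q = {q. 2 \<le> q \<and> supp q (lk q)}"
    have fin: "finite Q" by (rule finite_subset[of _ "{..m}"]) (auto simp: Q_def supp_def lab_def)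
    have "Max Q \<in> Q" using True fin by (intro Max_in) (auto simp: Q_def)
    moreover have "Suc (Max Q) \<notin> Q" using Max_ge[OF fin, of "Suc (Max Q)"] by auto
    ultimately have "\<forall>i. lab (Max Q) i \<and> node (Max Q, i) \<in> K \<longrightarrow> supp (Max Q) i"
      using supp_cases[of "Max Q"] by (auto simp: Q_def)
    with \<open>Max Q \<in> Q\<close> show ?thesis by (auto simp: Q_def)
  next
    case False
    \<comment> \<open>Now no link is supported from its upper cycle, and minimality of
      \<open>q\<close> excludes support from the lower one.\<close>
    define q where "q = (LEAST q. \<exists>i. supp q i)"
    have "\<exists>q i. supp q i" using supp_ex K(1) by blast
    then have q: "\<exists>i. supp q i" unfolding q_def by (rule LeastI_ex)
    have least: "\<not> supp (q - 1) 1" if "2 \<le> q"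
      using not_less_Least[of "q - 1" "\<lambda>q. \<exists>i. supp q i"] that unfolding q_def by auto
    have "\<not> supp (Suc q) (lk (Suc q))"
    proof
      assume h: "supp (Suc q) (lk (Suc q))"
      have "1 \<le> q" using q by (auto simp: supp_def lab_def)
      with h False show False by (metis Suc_1 Suc_le_mono One_nat_def)
    qed
    with least supp_cases[of q] have "\<forall>i. lab q i \<and> node (q, i) \<in> K \<longrightarrow> supp q i"
      by blast
    with q show ?thesis by blast
  qed
  then obtain q i0 where q: "supp q i0" "\<And>i. lab q i \<Longrightarrow> node (q, i) \<in> K \<Longrightarrow> supp q i"
    by blast
  have qm: "1 \<le> q" "q \<le> m" and i0: "i0 \<in> {1..n}" using q(1) by (auto simp: supp_def lab_def)
  have all: "\<forall>i\<in>{1..n}. supp q i"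
  proof (rule cycle_induct[where P = "supp q", OF i0 q(1)])
    show "supp q n" if "supp q 1"
      using that qm n_ge by (intro q(2)) (auto simp: supp_def lab_def p_def)
    show "supp q (i - 1)" if "2 \<le> i" "i \<le> n" "supp q i" for i
      using that qm by (intro q(2)) (auto simp: supp_def lab_def p_def)
  qed
  have "mono_cycle s' q"
    unfolding mono_cycle_def
  proof (rule cycle_induct[where ?i0.0 = 1 and P = "\<lambda>i. col s' q i = col s' q 1"])
    have eq: "col s' q (p i) = col s' q i" if "1 \<le> i" "i \<le> n" for i
      using all that by (auto simp: supp_def)
    from eq[of 1] show "col s' q n = col s' q 1"
      using n_ge by (simp add: p_def)
    show "col s' q (i - 1) = col s' q 1" if "2 \<le> i" "i \<le> n" "col s' q i = col s' q 1" for i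
      using eq[of i] that by (simp add: p_def)
  qed (use n_ge in auto)
  moreover have "\<not> mono_cycle s q"
  proof
    assume "mono_cycle s q"
    from mono_cycle_frozen[OF dev this qm] n_ge have "col s' q 1 = col s q 1" by simp
    moreover have "node (q, 1) \<in> K" using all n_ge by (auto simp: supp_def)
    ultimately show False using K(3) by (auto simp: col_def)
  qed
  ultimately show thesis using that qm by blast
qed

section \<open>State of the sweep and potential\<close>

text \<open>The colour of \<open>n\<^sup>q\<close> is unavailable at the link \<open>1\<^sup>q\<close>, which therefore can only follow its
  predecessor in the next cycle.\<close>

definition barred :: "('v \<Rightarrow> 'c) \<Rightarrow> nat \<Rightarrow> bool" where
  "barred s q \<longleftrightarrow> col s q n \<notin> C (node (q, 1))"

text \<open>A link is barred, loose, or already agrees with \<open>node (q, n)\<close>. A loose one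
  may lock on to that colour once the sweep is over.\<close>

definition loose :: "('v \<Rightarrow> 'c) \<Rightarrow> nat \<Rightarrow> bool" where
  "loose s q \<longleftrightarrow> col s q n \<in> C (node (q, 1)) \<and> col s q n \<noteq> col s q 1"

text \<open>The node at position \<open>i\<close> of cycle \<open>q\<close> would move in the sweep of the tree. Links that are not
  barred do not take part in the sweep.\<close>

definition pending :: "('v \<Rightarrow> 'c) \<Rightarrow> nat \<Rightarrow> nat \<Rightarrow> bool" where
  "pending s q i \<longleftrightarrow> 1 \<le> q \<and> q \<le> m \<and> 2 \<le> i \<and> i \<le> n \<and> col s q i \<noteq> col s q (i - 1)
    \<and> col s q (i - 1) \<in> C (node (q, i)) \<and> (i = lk q \<longrightarrow> barred s (q - 1))"

definition topmost :: "('v \<Rightarrow> 'c) \<Rightarrow> nat \<Rightarrow> bool" where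
  "topmost s q \<longleftrightarrow> (\<forall>r i. q < r \<longrightarrow> \<not> pending s r i)"

definition front :: "('v \<Rightarrow> 'c) \<Rightarrow> nat \<Rightarrow> nat \<Rightarrow> bool" where
  "front s q i \<longleftrightarrow> (\<forall>j. 1 \<le> j \<longrightarrow> j < i \<longrightarrow> col s q j = col s q 1)"

text \<open>A clean cycle is one in which no pending node can change the colour of \<open>n\<^sup>q\<close> without making
  the cycle monochromatic. Lower cycles may still receive a new colour at position \<open>1\<close>, which
  preserves cleanness only if position \<open>2\<close> is the sole pending one.\<close>

definition dirty :: "('v \<Rightarrow> 'c) \<Rightarrow> nat \<Rightarrow> bool" where
  "dirty s q \<longleftrightarrow> (\<exists>i. pending s q i \<and> i \<noteq> 2 \<and> \<not> (topmost s q \<and> front s q i))"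

definition source :: "('v \<Rightarrow> 'c) \<Rightarrow> nat \<Rightarrow> bool" where
  "source s q \<longleftrightarrow> loose s q \<or> dirty s q"

text \<open>A colour entering or arising in cycle \<open>l\<close> may pass down through a run of barred links. The cycle
  \<open>r\<close> is reached if this can happen in the current sweep, and exposed if it can happen
  after a later move of a loose link.\<close>

definition inflow :: "('v \<Rightarrow> 'c) \<Rightarrow> nat \<Rightarrow> bool" where
  "inflow s q \<longleftrightarrow> dirty s q \<or> (\<exists>i\<le>lk q. pending s q i)"

definition run :: "('v \<Rightarrow> 'c) \<Rightarrow> nat \<Rightarrow> nat \<Rightarrow> bool" where
  "run s r l \<longleftrightarrow> r < l \<and> l \<le> m \<and> (\<forall>j. r \<le> j \<longrightarrow> j < l \<longrightarrow> barred s j)"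

definition reached :: "('v \<Rightarrow> 'c) \<Rightarrow> nat \<Rightarrow> bool" where
  "reached s r \<longleftrightarrow> (\<exists>l. run s r l \<and> inflow s l)"

definition exposed :: "('v \<Rightarrow> 'c) \<Rightarrow> nat \<Rightarrow> bool" where
  "exposed s r \<longleftrightarrow> (\<exists>l. run s r l \<and> source s l)"

text \<open>If nothing flows in, only positions from the first pending one up to \<open>n\<close>
  can move, which gives \<open>Suc n - i\<close>. A reached cycle is charged \<open>n\<close>, which
  is more since pending positions are at least \<open>2\<close>.\<close>

definition sweep_cost :: "('v \<Rightarrow> 'c) \<Rightarrow> nat \<Rightarrow> nat" where
  "sweep_cost s r = (if reached s r then n
    else if \<exists>i. pending s r i then Suc n - (LEAST i. pending s r i) else 0)"

definition cost :: "('v \<Rightarrow> 'c) \<Rightarrow> nat \<Rightarrow> nat" where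
  "cost s r = sweep_cost s r + (if exposed s r then n else 0)"

text \<open>Sources travel upwards, so the weight falls with \<open>r\<close>, staying positive at
  \<open>r = m\<close>.\<close>

definition source_weight :: "('v \<Rightarrow> 'c) \<Rightarrow> nat \<Rightarrow> nat" where
  "source_weight s r = (if source s r then Suc m - r else 0)"

text \<open>When a source at \<open>p\<close> disappears, new sources arise only above \<open>p\<close>, and only one of them;
  the costs of at most three cycles increase, each by at most \<open>2 n\<close>. This explains the factor
  \<open>7 n > 6 n\<close>.\<close>

definition potential :: "('v \<Rightarrow> 'c) \<Rightarrow> nat" where
  "potential s = (\<Sum>r=1..m. cost s r) + 7 * n * (\<Sum>r=1..m. source_weight s r)"

lemma frontD: "front s q i \<Longrightarrow> 1 \<le> j \<Longrightarrow> j < i \<Longrightarrow> col s q j = col s q 1"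
  unfolding front_def by blast

lemma sweep_cost_le: "sweep_cost s r \<le> n"
proof -
  have ge: "2 \<le> i" if "pending s r i" for i
    using that by (simp add: pending_def)
  have "Suc n - (LEAST i. pending s r i) \<le> n" if "\<exists>i. pending s r i"
    using ge[OF LeastI_ex[OF that]] by linarith
  then show ?thesis unfolding sweep_cost_def by simp
qed

lemma cost_le: "cost s r \<le> 2 * n"
  using sweep_cost_le[of s r] by (auto simp: cost_def)

lemma cost_mono:
  assumes "exposed s' r \<Longrightarrow> exposed s r" "sweep_cost s' r \<le> sweep_cost s r"
  shows "cost s' r \<le> cost s r"
  using assms by (auto simp: cost_def)

lemma sweep_cost_mono:
  assumes "reached s' r \<Longrightarrow> reached s r" "\<not> reached s r \<Longrightarrow> pending s' r = pending s r"
  shows "sweep_cost s' r \<le> sweep_cost s r"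
proof (cases "reached s r")
  case True
  then show ?thesis using sweep_cost_le by (simp add: sweep_cost_def)
next
  case False
  with assms show ?thesis by (auto simp: sweep_cost_def)
qed

text \<open>Costs contribute at most \<open>2 * n * m\<close>, weights at most
  \<open>7 * n * m\<^sup>2\<close>.\<close>

lemma potential_le: "potential s \<le> 9 * n * m\<^sup>2"
proof -
  have "(\<Sum>r=1..m. cost s r) \<le> (\<Sum>r=1..m. 2 * n)"
    by (intro sum_mono cost_le)
  moreover have "(\<Sum>r=1..m. source_weight s r) \<le> (\<Sum>r=1..m. m)"
    by (intro sum_mono) (auto simp: source_weight_def)
  ultimately have "potential s \<le> m * (2 * n) + 7 * n * (m * m)"
    by (simp add: potential_def add_mono)
  also have "m * (2 * n) \<le> 2 * n * (m * m)"
    by (cases m) auto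
  finally show ?thesis by (simp add: power2_eq_square algebra_simps)
qed

lemma potential_less_local:
  assumes "\<And>r. 1 \<le> r \<Longrightarrow> r \<le> m \<Longrightarrow> source s' r \<Longrightarrow> source s r"
    and "\<And>r. 1 \<le> r \<Longrightarrow> r \<le> m \<Longrightarrow> cost s' r \<le> cost s r"
    and "1 \<le> q" "q \<le> m" "cost s' q < cost s q"
  shows "potential s' < potential s"
proof -
  have "(\<Sum>r=1..m. cost s' r) < (\<Sum>r=1..m. cost s r)"
    using assms by (intro sum_strict_mono_ex1) auto
  moreover have "(\<Sum>r=1..m. source_weight s' r) \<le> (\<Sum>r=1..m. source_weight s r)"
    using assms(1) by (intro sum_mono) (auto simp: source_weight_def)
  ultimately show ?thesis
    unfolding potential_def by (intro add_less_le_mono mult_le_mono2)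
qed

lemma potential_less_hop:
  assumes p: "1 \<le> p" "p \<le> m" "source s p" "\<not> source s' p"
    and a: "p < a" "\<And>r. 1 \<le> r \<Longrightarrow> r \<le> m \<Longrightarrow> r \<noteq> a \<Longrightarrow> source s' r \<Longrightarrow> source s r"
    and cost: "\<And>r. 1 \<le> r \<Longrightarrow> r \<le> m \<Longrightarrow> r < p \<or> p + 2 < r \<Longrightarrow> cost s' r \<le> cost s r"
  shows "potential s' < potential s"
proof -
  have "(\<Sum>r=1..m. cost s' r) \<le> (\<Sum>r=1..m. cost s r + (if r \<in> {p..p+2} then 2 * n else 0))"
  proof (rule sum_mono)
    fix r assume "r \<in> {1..m}"
    then show "cost s' r \<le> cost s r + (if r \<in> {p..p+2} then 2 * n else 0)"
      using cost[of r] cost_le[of s' r] by (cases "r \<in> {p..p+2}") auto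
  qed
  also have "\<dots> = (\<Sum>r=1..m. cost s r) + (\<Sum>r\<in>{1..m} \<inter> {p..p+2}. 2 * n)"
    unfolding sum.distrib sum.inter_restrict[OF finite_atLeastAtMost] ..
  also have "(\<Sum>r\<in>{1..m} \<inter> {p..p+2}. 2 * n) \<le> (\<Sum>r\<in>{p..p+2}. 2 * n)"
    by (intro sum_mono2) auto
  also have "\<dots> = 6 * n" by simp
  finally have A: "(\<Sum>r=1..m. cost s' r) \<le> (\<Sum>r=1..m. cost s r) + 6 * n" by simp
  \<comment> \<open>The weights of \<open>p\<close> and \<open>a\<close> are added on opposite sides
    to avoid subtraction; if \<open>a\<close> exceeds \<open>m\<close>, it adds nothing.\<close>
  have "(\<Sum>r=1..m. source_weight s' r + (if r = p then Suc m - p else 0))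
      \<le> (\<Sum>r=1..m. source_weight s r + (if r = a then Suc m - a else 0))"
    using p a by (intro sum_mono) (auto simp: source_weight_def)
  then have "(\<Sum>r=1..m. source_weight s' r) + (Suc m - p)
      \<le> (\<Sum>r=1..m. source_weight s r) + (Suc m - a)"
    using p by (simp add: sum.distrib split: if_splits)
  with p a have "Suc (\<Sum>r=1..m. source_weight s' r) \<le> (\<Sum>r=1..m. source_weight s r)"
    by linarith
  then have "7 * n * Suc (\<Sum>r=1..m. source_weight s' r) \<le> 7 * n * (\<Sum>r=1..m. source_weight s r)"
    by (rule mult_le_mono2)
  with A n_ge show ?thesis by (simp add: potential_def)
qed

section \<open>Moves of the sweep\<close>

lemma lk_bounds: "1 \<le> q \<Longrightarrow> q \<le> m \<Longrightarrow> lk q = 0 \<and> q = 1 \<or> 2 \<le> q \<and> 2 \<le> lk q \<and> lk q \<le> n"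
  using k_bounds[of "q - 1"] by (auto simp: lk_def)

lemma node_lk: "2 \<le> q \<Longrightarrow> q \<le> m \<Longrightarrow> node (q, lk q) = node (q - 1, 1)"
  using node_link[of "q - 1"] by (simp add: lk_def)

lemma pending_range: "pending s q i \<Longrightarrow> 1 \<le> q \<and> q \<le> m \<and> 2 \<le> i \<and> i \<le> n"
  by (simp add: pending_def)

text \<open>A pending node has payoff zero: it disagrees with its predecessor on the cycle, and if
  it is a link, the colour from the lower cycle is barred.\<close>

lemma follow_improves:
  assumes s: "s \<in> joint_strategies" and p: "pending s q i"
  shows "improvement_step s (s(node (q, i) := col s q (i - 1)))" (is "improvement_step s ?s'")
proof (rule single_step[OF s])
  have lab: "lab q i" and i: "2 \<le> i" using p by (auto simp: pending_def lab_def)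
  show "node (q, i) \<in> pverts G" using lab pverts_lab by blast
  show "col s q (i - 1) \<in> C (node (q, i))" using p by (simp add: pending_def)
  have "col s (q - 1) n \<noteq> col s q i" if "i = lk q"
  proof -
    have "2 \<le> q" "q \<le> m" using that p lk_bounds[of q] by (auto simp: pending_def)
    then have "col s (q - 1) n \<notin> C (node (q, i))"
      using p that node_lk[of q] by (simp add: pending_def barred_def)
    then show ?thesis using col_in[OF s lab] by auto
  qed
  then have "payoff s (node (q, i)) = 0"
    using p by (auto simp: payoff_node[OF lab i] pending_def)
  moreover have "lab q (i - 1)" using lab i by (auto simp: lab_def)
  then have "payoff ?s' (node (q, i)) \<noteq> 0"
    using lab i by (simp add: payoff_node col_upd_node)
  ultimately show "payoff s (node (q, i)) < payoff ?s' (node (q, i))" by simp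
qed

text \<open>Cycles are swept from the highest pending one downwards, so that meanwhile the lower ones
  receive new colours at position \<open>1\<close> only and stay clean.\<close>

lemma follow_progress:
  assumes s: "s \<in> joint_strategies" and p: "pending s q i" and topmost: "topmost s q"
    and first: "\<And>j. j < i \<Longrightarrow> \<not> pending s q j"
  defines "s' \<equiv> s(node (q, i) := col s q (i - 1))"
  shows "mono_cycle s' q \<and> \<not> mono_cycle s q \<or> potential s' < potential s"
proof -
  have q: "1 \<le> q" "q \<le> m" and i: "2 \<le> i" "i \<le> n" and lab: "lab q i"
    using p by (auto simp: pending_def lab_def)
  have col': "col s' r j = (if (r = q \<and> j = i) \<or> (i = lk q \<and> q = Suc r \<and> j = 1)
      then col s q (i - 1) else col s r j)" if "lab r j" for r j
    using col_upd_node[OF lab i(1) that] by (simp add: s'_def)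
  have high: "\<not> pending s r j" if "q < r" for r j
    using topmost that by (simp add: topmost_def)
  have link: "q = Suc r \<Longrightarrow> i = lk q \<Longrightarrow> barred s r" for r
    using p by (simp add: pending_def)
  have barred': "barred s' r = barred s r" if "1 \<le> r" "r \<le> m" "r \<noteq> q \<or> i \<noteq> n" for r
    using that n_ge col'[of r n] by (auto simp: barred_def lab_def)
  \<comment> \<open>If the moved node is a link, it is barred before and after the move, hence not
    loose.\<close>
  have loose': "loose s r" if "loose s' r" "1 \<le> r" "r \<le> m" "r \<noteq> q \<or> i \<noteq> n" for r
  proof -
    have "\<not> (i = lk q \<and> q = Suc r)"
      using link[of r] barred'[of r] that by (auto simp: loose_def barred_def)
    then show ?thesis
      using that n_ge i col'[of r n] col'[of r 1] by (auto simp: loose_def lab_def)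
  qed
  \<comment> \<open>Above \<open>q\<close>, only the link of the next cycle can become pending, when
    it bars the new colour of \<open>node (q, n)\<close>.\<close>
  have pending_high: "r = Suc q \<and> i = n \<and> j = lk r \<and> barred s' q" if "pending s' r j" "q < r" for r j
  proof -
    have "lab r j" "lab r (j - 1)" using that by (auto simp: pending_def lab_def)
    then have "col s' r j = col s r j" "col s' r (j - 1) = col s r (j - 1)"
      using col' that by auto
    then have "j = lk r" "\<not> barred s (r - 1)" "barred s' (r - 1)"
      using that high[of r j] by (auto simp: pending_def)
    moreover have "1 \<le> r - 1" "r - 1 \<le> m" using that q by (auto simp: pending_def)
    ultimately have "r - 1 = q \<and> i = n" using barred'[of "r - 1"] by blast
    with \<open>j = lk r\<close> \<open>barred s' (r - 1)\<close> that show ?thesis by auto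
  qed
  \<comment> \<open>A moved link is position \<open>1\<close> of the lower cycle, so only position
    \<open>2\<close> there is affected.\<close>
  have pending_low: "pending s' r j = pending s r j"
    if "r < q" "j \<noteq> 2 \<or> \<not> (i = lk q \<and> q = Suc r)" for r j
  proof (cases "1 \<le> r \<and> 2 \<le> j \<and> j \<le> n")
    case True
    then have "lab r j" "lab r (j - 1)" using that q by (auto simp: lab_def)
    then have "col s' r j = col s r j" "col s' r (j - 1) = col s r (j - 1)"
      using col' that True by auto
    moreover have "barred s' (r - 1) = barred s (r - 1)" if "j = lk r"
      using True lk_bounds[of r] that \<open>r < q\<close> q by (intro barred') auto
    ultimately show ?thesis by (auto simp: pending_def)
  qed (auto simp: pending_def)
  have pending_same: "i < j \<and> (Suc i < j \<longrightarrow> pending s q j)" if pj: "pending s' q j" for j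
  proof -
    have j: "2 \<le> j" "j \<le> n" using pj by (auto simp: pending_def)
    then have lj: "lab q j" "lab q (j - 1)" using q by (auto simp: lab_def)
    have b: "barred s' (q - 1) = barred s (q - 1)" if "j = lk q"
      using j lk_bounds[of q] that q by (intro barred') auto
    have "j \<noteq> i" using pj lj col'[of q i] col'[of q "i - 1"] i by (auto simp: pending_def)
    moreover have "pending s q j" if "j \<noteq> i" "j \<noteq> Suc i"
    proof -
      have "col s' q j = col s q j" "col s' q (j - 1) = col s q (j - 1)"
        using col'[OF lj(1)] col'[OF lj(2)] that j by auto
      with pj b show ?thesis by (simp add: pending_def)
    qed
    ultimately show ?thesis using first[of j] by force
  qed
  \<comment> \<open>Cycle \<open>r\<close> is not topmost before the move, so each pending position
    except \<open>2\<close> already made it dirty.\<close>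
  have dirty_low: "dirty s r" if d: "dirty s' r" "r < q" for r
  proof -
    obtain j where "pending s' r j" "j \<noteq> 2" using d by (auto simp: dirty_def)
    moreover have "\<not> topmost s r" using p d(2) by (auto simp: topmost_def)
    ultimately show ?thesis using pending_low[of r j] d(2) by (auto simp: dirty_def)
  qed
  \<comment> \<open>In a clean cycle the colour of position \<open>1\<close> reaches
    \<open>i - 1\<close>, and no position beyond \<open>Suc i\<close> was pending. The move extends
    that colour to \<open>i\<close>, so a pending successor is at the front again.\<close>
  have dirty_same: "dirty s q" if d: "dirty s' q" and "i < n"
  proof (rule ccontr)
    assume clean: "\<not> dirty s q"
    obtain j where j: "pending s' q j" "j \<noteq> 2" "\<not> (topmost s' q \<and> front s' q j)"
      using d by (auto simp: dirty_def)
    have "topmost s' q" using pending_high \<open>i < n\<close> by (auto simp: topmost_def)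
    with j have nf: "\<not> front s' q j" by simp
    show False
    proof (cases "Suc i < j")
      case True
      then have pj: "pending s q j" using pending_same[OF j(1)] by simp
      then have "front s q j" using clean j(2) by (auto simp: dirty_def)
      then have "col s q i = col s q 1" "col s q (i - 1) = col s q 1"
        using frontD[OF \<open>front s q j\<close>, of i] frontD[OF \<open>front s q j\<close>, of "i - 1"] True i
        by (simp_all del: One_nat_def)
      with p show False by (simp add: pending_def)
    next
      case False
      then have [simp]: "j = Suc i" using pending_same[OF j(1)] by simp
      have "front s q i"
      proof (cases "i = 2")
        case True
        then show ?thesis by (simp add: front_def less_Suc_eq numeral_2_eq_2)
      qed (use clean p in \<open>auto simp: dirty_def\<close>)
      then have eq: "col s q l = col s q 1" if "1 \<le> l" "l < i" for l
        using frontD[OF \<open>front s q i\<close>] that by blast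
      have "front s' q j"
        unfolding front_def
      proof (intro allI impI)
        fix l assume l: "1 \<le> l" "l < j"
        then have "lab q l" "lab q 1" using lab i by (auto simp: lab_def)
        then show "col s' q l = col s' q 1"
          using col'[of q l] col'[of q 1] l i eq[of l] eq[of "i - 1"]
          by (cases "l = i") auto
      qed
      with nf show False by simp
    qed
  qed
  have run': "run s' r l = run s r l" if "1 \<le> r" "q < r \<or> l \<le> q \<or> i < n" for r l
    using that barred' q i by (auto simp: run_def)
  have not_reached: "\<not> reached s r" if "q \<le> r" for r
    using high that by (auto simp: reached_def run_def inflow_def dirty_def)
  have least: "(LEAST j. pending s q j) = i"
    using p first by (intro Least_equality) (auto simp: not_less[symmetric])
  then have cost_q: "sweep_cost s q = Suc n - i"
    using not_reached p by (auto simp: sweep_cost_def)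
  have inflow_low: "inflow s l \<or> (q = Suc l \<and> i = lk q)" if h: "inflow s' l" "l < q" for l
  proof -
    from h(1) consider "dirty s' l" | j where "j \<le> lk l" "pending s' l j"
      by (auto simp: inflow_def)
    then show ?thesis
    proof cases
      case 1
      then show ?thesis using dirty_low h(2) by (auto simp: inflow_def)
    next
      case 2
      then show ?thesis using pending_low[of l j] h(2) by (auto simp: inflow_def)
    qed
  qed
  have reached_low: "reached s r" if r: "1 \<le> r" "run s' r l" "inflow s' l" "l < q" for r l
  proof -
    have run: "run s r l" using run'[of r l] r by simp
    from inflow_low[OF r(3,4)] show ?thesis
    proof
      assume "inflow s l"
      with run show ?thesis by (auto simp: reached_def)
    next
      \<comment> \<open>The new inflow passes a barred link, so \<open>r\<close> was already reached
        from \<open>q\<close>, where the pending link counts as inflow.\<close>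
      assume "q = Suc l \<and> i = lk q"
      then have "run s r q" "inflow s q"
        using run link[of l] q p by (auto simp: run_def inflow_def less_Suc_eq)
      then show ?thesis by (auto simp: reached_def)
    qed
  qed
  have sweep_low: "sweep_cost s' r \<le> sweep_cost s r"
    if "r < q" "1 \<le> r" "reached s' r \<Longrightarrow> reached s r" for r
  proof (rule sweep_cost_mono)
    assume "\<not> reached s r"
    moreover have "reached s r" if ql: "q = Suc r" "i = lk q"
    proof -
      have "run s r q" using ql link[of r] q by (auto simp: run_def less_Suc_eq)
      moreover have "inflow s q" using p ql by (auto simp: inflow_def)
      ultimately show ?thesis by (auto simp: reached_def)
    qed
    ultimately show "pending s' r = pending s r"
      using pending_low[OF that(1)] by blast
  qed (use that in blast)
  show ?thesis
  \<comment> \<open>Either \<open>node (q, n)\<close> keeps its colour, or \<open>q\<close> was a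
    source already and remains one. No source arises in these cases, so the sweep cost of
    \<open>q\<close> decides.\<close>
  proof (cases "i < n \<or> loose s' q \<and> dirty s q")
    case True
    have high': "\<not> pending s' r j" if "q < r" for r j
      using True pending_high[OF _ that] by (auto simp: loose_def barred_def)
    have none: "\<not> pending s' q j" if "i = n" for j
      using pending_same[of j] that pending_range[of s' q j] by auto
    have source': "source s r" if r: "source s' r" "1 \<le> r" "r \<le> m" for r
    proof (cases "r = q \<and> i = n")
      case True
      with \<open>i < n \<or> loose s' q \<and> dirty s q\<close> show ?thesis by (auto simp: source_def)
    next
      case False
      with r(1) loose'[of r] r(2,3) have "loose s r \<or> dirty s' r" by (auto simp: source_def)
      moreover have "dirty s r" if "dirty s' r"
        using that dirty_low[of r] dirty_same high'[of r] False i
        by (cases r q rule: linorder_cases) (auto simp: dirty_def[of s' r])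
      ultimately show ?thesis by (auto simp: source_def)
    qed
    have inflow_q: "inflow s q" if "inflow s' q"
    proof -
      have "i < n" using that none i by (cases "i = n") (auto simp: inflow_def dirty_def)
      with that consider "dirty s q" | j where "j \<le> lk q" "pending s' q j"
        using dirty_same by (auto simp: inflow_def)
      then show ?thesis
      proof cases
        case 2
        with pending_same[of j] p show ?thesis by (auto simp: inflow_def intro!: exI[of _ i])
      qed (simp add: inflow_def)
    qed
    have run_eq: "run s r l" if "run s' r l" "1 \<le> r" for r l
    proof (cases "q < r \<or> l \<le> q \<or> i < n")
      case False
      with True that(1) have "barred s' q" "loose s' q" by (auto simp: run_def)
      then show ?thesis by (auto simp: barred_def loose_def)
    qed (use run' that in blast)
    have reached': "reached s r" if r: "reached s' r" "1 \<le> r" for r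
    proof -
      obtain l where l: "run s' r l" "inflow s' l" using r by (auto simp: reached_def)
      then have "l \<le> q" using high'[of l] by (auto simp: inflow_def dirty_def not_less[symmetric])
      then show ?thesis
        using l reached_low[OF r(2) l] inflow_q run_eq[OF l(1) r(2)]
        by (cases "l = q") (auto simp: reached_def)
    qed
    have exposed': "exposed s r" if r: "exposed s' r" "1 \<le> r" for r
    proof -
      obtain l where l: "run s' r l" "source s' l" using r by (auto simp: exposed_def)
      then have "run s r l" "source s l"
        using run_eq r source' by (auto simp: run_def)
      then show ?thesis by (auto simp: exposed_def)
    qed
    have less: "sweep_cost s' q < sweep_cost s q"
    proof (cases "\<exists>j. pending s' q j")
      case ex: True
      then have "i < (LEAST j. pending s' q j)"
        using LeastI_ex[OF ex] pending_same by blast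
      then show ?thesis
        using cost_q not_reached[of q] reached' q i ex by (auto simp: sweep_cost_def)
    next
      case False
      then show ?thesis
        using cost_q not_reached[of q] reached' q i by (auto simp: sweep_cost_def)
    qed
    have "potential s' < potential s"
    proof (rule potential_less_local)
      show "cost s' r \<le> cost s r" if "1 \<le> r" "r \<le> m" for r
      proof (rule cost_mono)
        show "sweep_cost s' r \<le> sweep_cost s r"
        proof (cases r q rule: linorder_cases)
          case greater
          with high high' that reached' show ?thesis
            by (intro sweep_cost_mono) (auto simp: fun_eq_iff)
        qed (use less sweep_low reached' that in auto)
      qed (use exposed' that in blast)
      show "cost s' q < cost s q"
        using less exposed'[of q] q by (auto simp: cost_def)
    qed (use source' q in auto)
    then show ?thesis ..
  next
    case False
    then have [simp]: "i = n" using i by simp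
    have none: "\<not> pending s' q j" for j
      using pending_same[of j] pending_range[of s' q j] by auto
    show ?thesis
    proof (cases "dirty s q")
      \<comment> \<open>The source \<open>q\<close> vanishes, and only the next cycle can become a
        new one, through its newly barred link.\<close>
      case True
      with False have "\<not> loose s' q" by simp
      then have nsource: "\<not> source s' q" using none by (auto simp: source_def dirty_def)
      have source': "source s r" if "source s' r" "1 \<le> r" "r \<le> m" "r \<noteq> Suc q" for r
      proof (cases r q rule: linorder_cases)
        case less
        with that loose'[of r] dirty_low[of r] show ?thesis by (auto simp: source_def)
      next
        case equal
        with that nsource show ?thesis by simp
      next
        case greater
        with that loose'[of r] pending_high[of r] show ?thesis
          by (auto simp: source_def dirty_def)
      qed
      have "potential s' < potential s"
      proof (rule potential_less_hop[OF q _ nsource])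
        show "source s q" using True by (simp add: source_def)
        show "cost s' r \<le> cost s r" if r: "1 \<le> r" "r \<le> m" "r < q \<or> q + 2 < r" for r
          using r(3)
        proof
          assume "r < q"
          \<comment> \<open>Whatever now arrives from \<open>q\<close> or above was already
            accounted for, since \<open>q\<close> was dirty before the move.\<close>
          have below: "run s r q" if "run s' r l" "q \<le> l" for l
            using that \<open>r < q\<close> r(1) q barred' by (auto simp: run_def)
          show ?thesis
          proof (rule cost_mono)
            show "exposed s r" if ex: "exposed s' r"
            proof -
              obtain l where l: "run s' r l" "source s' l" using ex by (auto simp: exposed_def)
              show ?thesis
              proof (cases "q \<le> l")
                case True
                with below l \<open>source s q\<close> show ?thesis by (auto simp: exposed_def)
              next
                case False
                then have "run s r l" "source s l"
                  using l run'[of r l] source'[of l] r by (auto simp: run_def)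
                then show ?thesis by (auto simp: exposed_def)
              qed
            qed
            show "sweep_cost s' r \<le> sweep_cost s r"
            proof (rule sweep_low[OF \<open>r < q\<close> r(1)])
              assume "reached s' r"
              then obtain l where l: "run s' r l" "inflow s' l" by (auto simp: reached_def)
              show "reached s r"
              proof (cases "q \<le> l")
                case True
                with below l \<open>dirty s q\<close> show ?thesis by (auto simp: reached_def inflow_def)
              qed (use l reached_low r in auto)
            qed
          qed
        next
          assume "q + 2 < r"
          then have np: "\<not> pending s' l j" if "r \<le> l" for l j
            using pending_high[of l j] that by auto
          show ?thesis
          proof (rule cost_mono)
            show "exposed s r" if ex: "exposed s' r"
            proof -
              obtain l where l: "run s' r l" "source s' l" using ex by (auto simp: exposed_def)
              then have "run s r l" "source s l"
                using run'[of r l] source'[of l] r \<open>q + 2 < r\<close> by (auto simp: run_def)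
              then show ?thesis by (auto simp: exposed_def)
            qed
            have "\<not> reached s' r"
              using np by (auto simp: reached_def run_def inflow_def dirty_def)
            then show "sweep_cost s' r \<le> sweep_cost s r"
              using np by (auto simp: sweep_cost_def)
          qed
        qed
      qed (use source' in auto)
      then show ?thesis ..
    next
      case False
      \<comment> \<open>As \<open>n\<close> is not \<open>2\<close>, cleanness makes the colour of
        position \<open>1\<close> reach \<open>n - 1\<close>; the move completes the cycle.\<close>
      then have "front s q n" using p n_ge by (auto simp: dirty_def)
      then have eq: "col s q j = col s q 1" if "1 \<le> j" "j < n" for j
        using frontD[OF \<open>front s q n\<close>] that by blast
      have "mono_cycle s' q"
        unfolding mono_cycle_def
      proof
        fix j assume "j \<in> {1..n}"
        then have "lab q j" "lab q 1" using q by (auto simp: lab_def)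
        then show "col s' q j = col s' q 1"
          using col'[of q j] col'[of q 1] n_ge eq[of j] eq[of "n - 1"] \<open>j \<in> {1..n}\<close>
          by (cases "j = n") auto
      qed
      moreover have "\<not> mono_cycle s q"
        using p eq[of "n - 1"] n_ge by (auto simp: mono_cycle_def pending_def)
      ultimately show ?thesis by blast
    qed
  qed
qed

section \<open>Moves of loose links and stability\<close>

text \<open>No predecessor shares the colour of the link before the move, and
  \<open>node (l, n)\<close> does afterwards.\<close>

lemma lock_improves:
  assumes s: "s \<in> joint_strategies" and l: "1 \<le> l" "l \<le> m" "loose s l"
    and up: "l < m \<Longrightarrow> col s (Suc l) (k l - 1) \<noteq> col s l 1"
  shows "improvement_step s (s(node (l, 1) := col s l n))" (is "improvement_step s ?s'")
proof (rule single_step[OF s])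
  have lab: "lab l 1" "lab l n" using l n_ge by (auto simp: lab_def)
  show "node (l, 1) \<in> pverts G" using lab pverts_lab by blast
  show "col s l n \<in> C (node (l, 1))" using l by (simp add: loose_def)
  have "payoff s (node (l, 1)) = 0"
    using l(3) up unfolding payoff_first[OF l(1,2)] loose_def by auto
  moreover have "col ?s' l n = col ?s' l 1"
    using col_upd_first[OF l(1,2) lab(1)] col_upd_first[OF l(1,2) lab(2)] n_ge by simp
  then have "payoff ?s' (node (l, 1)) \<noteq> 0"
    unfolding payoff_first[OF l(1,2)] by simp
  ultimately show "payoff s (node (l, 1)) < payoff ?s' (node (l, 1))" by simp
qed

text \<open>A link that is not barred agrees with its lower predecessor, or with its upper one if it
  is loose; another colour matches at most one predecessor and gains nothing. Other nodes of
  positive in-cycle position \<open>2\<close> or more, and barred links, could only follow their own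
  cycle, but none is pending.\<close>

lemma stable_if_quiet:
  assumes s: "s \<in> joint_strategies" and quiet: "\<And>q i. \<not> pending s q i"
    and settled: "\<And>l. 1 \<le> l \<Longrightarrow> l \<le> m \<Longrightarrow> loose s l \<Longrightarrow> l < m \<and> col s (Suc l) (k l - 1) = col s l 1"
    and v: "v \<in> pverts G" and c: "c \<in> C v"
  shows "payoff (s(v := c)) v \<le> payoff s v"
proof (cases "c = s v")
  case True
  then show ?thesis by simp
next
  case cs: False
  from v show ?thesis
  proof (cases rule: node_cases)
    case (1 q i)
    note lab = 1(1) and i = 1(2)
    have q: "1 \<le> q" "q \<le> m" using lab by (auto simp: lab_def)
    have labp: "lab q (i - 1)" using lab i by (auto simp: lab_def)
    have sv: "s v = col s q i" using 1 by (simp add: col_def)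
    have "col (s(v := c)) q (i - 1) = col s q (i - 1)" "col (s(v := c)) q i = c"
      using col_upd_node[OF lab i labp, of s c] col_upd_node[OF lab i lab, of s c] i 1 by auto
    moreover have "col (s(v := c)) (q - 1) n = col s (q - 1) n" if "i = lk q"
    proof -
      have "lab (q - 1) n" using that i q n_ge lk_bounds[of q] by (auto simp: lab_def)
      with col_upd_node[OF lab i this, of s c] n_ge q 1 show ?thesis by (auto simp: lab_def)
    qed
    ultimately have new: "payoff (s(v := c)) v = of_bool (col s q (i - 1) = c)
        + of_bool (i = lk q \<and> col s (q - 1) n = c)"
      using payoff_node[OF lab i, of "s(v := c)"] 1 by auto
    have old: "payoff s v = of_bool (col s q (i - 1) = col s q i)
        + of_bool (i = lk q \<and> col s (q - 1) n = col s q i)"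
      using payoff_node[OF lab i, of s] 1 by simp
    show ?thesis
    proof (cases "i = lk q \<and> \<not> barred s (q - 1)")
      case True
      then have q2: "2 \<le> q" using i q lk_bounds[of q] by auto
      then have "node (q - 1, 1) = v" and lk: "k (q - 1) = i"
        using node_lk[of q] q True 1 by (auto simp: lk_def)
      then have first: "col s (q - 1) 1 = col s q i"
        using sv by (simp add: col_def)
      show ?thesis
      proof (cases "loose s (q - 1)")
        case True
        with settled[of "q - 1"] q2 q lk first have "col s q (i - 1) = col s q i" by simp
        with new old cs sv show ?thesis by auto
      next
        case False
        with True first have "col s (q - 1) n = col s q i"
          by (auto simp: loose_def barred_def)
        with new old cs sv show ?thesis using True by auto
      qed
    next
      case False
      have "col s (q - 1) n \<noteq> c" if "i = lk q"
      proof -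
        have "2 \<le> q" using that i q lk_bounds[of q] by auto
        then have "node (q - 1, 1) = v" using node_lk[of q] q that 1 by auto
        with False that c show ?thesis by (auto simp: barred_def)
      qed
      moreover have "col s q (i - 1) = col s q i" if "col s q (i - 1) = c"
        using quiet[of q i] that False c 1 q i by (auto simp: pending_def lab_def)
      ultimately show ?thesis using new old by auto
    qed
  next
    case 2
    have lab: "lab m 1" "lab m n" using m_ge n_ge by (auto simp: lab_def)
    have m: "1 \<le> m" using m_ge by simp
    have "col (s(v := c)) m n = col s m n" "col (s(v := c)) m 1 = c"
      using col_upd_first[OF m order_refl lab(2), of s c] col_upd_first[OF m order_refl lab(1), of s c]
        2 n_ge by auto
    then have new: "payoff (s(v := c)) v = of_bool (col s m n = c)"
      using payoff_first[OF m order_refl, of "s(v := c)"] 2 by simp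
    have "col s m n = c \<Longrightarrow> loose s m \<or> col s m n = col s m 1"
      using c 2 by (auto simp: loose_def)
    then have "col s m n = c \<Longrightarrow> col s m n = col s m 1"
      using settled[of m] m by blast
    then show ?thesis
      using new payoff_first[OF m order_refl, of s] 2 by auto
  qed
qed

text \<open>Locking ends the source \<open>l\<close>. The new colour enters cycles \<open>l\<close>
  and \<open>Suc l\<close>, and it reaches further up at once only if the link is the last node of
  cycle \<open>Suc l\<close>.\<close>

lemma lock_progress:
  assumes quiet: "\<And>q i. \<not> pending s q i" and l: "1 \<le> l" "l \<le> m" "loose s l"
  shows "potential (s(node (l, 1) := col s l n)) < potential s"
proof -
  define s' where "s' = s(node (l, 1) := col s l n)"
  have col': "col s' r j = (if (r = l \<and> j = 1) \<or> (r = Suc l \<and> j = k l) then col s l n else col s r j)"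
    if "lab r j" for r j
    using col_upd_first[OF l(1,2) that] by (simp add: s'_def)
  have clean: "\<not> dirty s r" for r using quiet by (simp add: dirty_def)
  have barred': "barred s' r = barred s r" if "1 \<le> r" "r \<le> m" "r \<noteq> Suc l" for r
    using that n_ge col'[of r n] by (auto simp: barred_def lab_def)
  have loose': "loose s' r = loose s r" if "1 \<le> r" "r \<le> m" "r \<noteq> l" "r \<noteq> Suc l" for r
    using that n_ge col'[of r n] col'[of r 1] by (auto simp: loose_def lab_def)
  have nloose: "\<not> loose s' l" and nbarred: "\<not> barred s' l"
    using l n_ge col'[of l n] col'[of l 1] by (auto simp: loose_def barred_def lab_def)
  have k1: "k l \<noteq> 1" if "l < m" using k_bounds[of l] l that by simp
  have pending': "(r = l \<and> j = 2) \<or> (r = Suc l \<and> j = Suc (k l))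
      \<or> (r = l + 2 \<and> k l = n \<and> barred s' (Suc l))" if pj: "pending s' r j" for r j
  proof (rule ccontr)
    assume not: "\<not> ?thesis"
    have r: "1 \<le> r" "r \<le> m" and j: "2 \<le> j" "j \<le> n" using pj by (auto simp: pending_def)
    then have lj: "lab r j" "lab r (j - 1)" by (auto simp: lab_def)
    have "j \<noteq> k l" if "r = Suc l"
      using that nbarred lk_Suc[of l] l pj by (auto simp: pending_def)
    then have "col s' r j = col s r j" "col s' r (j - 1) = col s r (j - 1)"
      using col'[OF lj(1)] col'[OF lj(2)] not j by auto
    moreover have "barred s (r - 1)" if "j = lk r"
    proof -
      have "barred s' (r - 1)" "2 \<le> r" using pj that j lk_bounds[of r] r by (auto simp: pending_def)
      moreover have "barred s' (r - 1) = barred s (r - 1)"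
      proof (cases "r - 1 = Suc l")
        case True
        then have "r = l + 2" using \<open>2 \<le> r\<close> by simp
        with not \<open>barred s' (r - 1)\<close> True have "k l \<noteq> n" by simp
        then show ?thesis
          using True r n_ge col'[of "Suc l" n] l by (auto simp: barred_def lab_def)
      next
        case False
        with \<open>2 \<le> r\<close> r show ?thesis by (intro barred') auto
      qed
      ultimately show ?thesis by simp
    qed
    ultimately show False using quiet[of r j] pj by (simp add: pending_def)
  qed
  have clean': "\<not> dirty s' r" if "r \<noteq> Suc l" "r = l + 2 \<longrightarrow> k l \<noteq> n \<or> \<not> barred s' (Suc l)" for r
    using pending' that by (auto simp: dirty_def)
  have "source s l" using l by (simp add: source_def)
  have nsource: "\<not> source s' l" using nloose clean'[of l] by (simp add: source_def)
  have source': "source s r"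
    if "source s' r" "1 \<le> r" "r \<le> m" "r \<noteq> Suc l" "r = l + 2 \<longrightarrow> k l \<noteq> n \<or> \<not> barred s' (Suc l)" for r
    using that nsource loose'[of r] clean'[of r] by (cases "r = l") (auto simp: source_def)
  have hop: "\<exists>a>l. \<forall>r. 1 \<le> r \<longrightarrow> r \<le> m \<longrightarrow> r \<noteq> a \<longrightarrow> source s' r \<longrightarrow> source s r"
  proof (cases "k l \<noteq> n \<or> \<not> barred s' (Suc l)")
    case True
    then show ?thesis using source' by (intro exI[of _ "Suc l"]) auto
  next
    \<comment> \<open>Here the link is the last node of cycle \<open>Suc l\<close>, which keeps no
      pending position and is barred, so only cycle \<open>l + 2\<close> can become a
      source.\<close>
    case False
    then have "\<not> pending s' (Suc l) j" for j
      using pending'[of "Suc l" j] pending_range[of s' "Suc l" j] by auto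
    then have "\<not> source s' (Suc l)"
      using False by (auto simp: source_def dirty_def loose_def barred_def)
    then show ?thesis using source' by (intro exI[of _ "l + 2"]) auto
  qed
  then obtain a where a: "l < a" "\<And>r. 1 \<le> r \<Longrightarrow> r \<le> m \<Longrightarrow> r \<noteq> a \<Longrightarrow> source s' r \<Longrightarrow> source s r"
    by blast
  have "potential s' < potential s"
  proof (rule potential_less_hop[OF l(1,2) \<open>source s l\<close> nsource a])
    show "cost s' r \<le> cost s r" if r: "1 \<le> r" "r \<le> m" "r < l \<or> l + 2 < r" for r
    proof -
      have np: "\<not> pending s' r j" for j using pending'[of r j] r by auto
      have "\<not> reached s r" using quiet clean by (auto simp: reached_def inflow_def)
      then have "sweep_cost s r = 0" 
        using quiet by (metis sweep_cost_def)
      have run': "run s r t \<and> (r < l \<longrightarrow> t \<le> l)" if "run s' r t" for t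
      proof -
        have "t \<le> l" if "r < l"
        proof (rule ccontr)
          assume "\<not> t \<le> l"
          with \<open>run s' r t\<close> \<open>r < l\<close> nbarred show False by (auto simp: run_def)
        qed
        with that r(1,3) barred' show ?thesis by (auto simp: run_def)
      qed
      have exposed': "exposed s r" if ex: "exposed s' r"
      proof -
        obtain t where "run s' r t" "source s' t" using ex by (auto simp: exposed_def)
        then have "run s r t" "source s t"
          using run'[of t] source'[of t] r by (auto simp: run_def)
        then show ?thesis by (auto simp: exposed_def)
      qed
      show ?thesis
      proof (cases "reached s' r")
        case False
        then have "sweep_cost s' r = 0" using np by (metis sweep_cost_def)
        then show ?thesis using exposed' by (intro cost_mono) auto
      next
        \<comment> \<open>A lower cycle becomes reached through cycle \<open>l\<close>, but it was
          exposed to the source \<open>l\<close> and is exposed no longer: the charge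
          \<open>n\<close> moves from exposure to the sweep.\<close>
        case True
        then obtain t where t: "run s' r t" "inflow s' t" by (auto simp: reached_def)
        then obtain j where "pending s' t j" by (auto simp: inflow_def dirty_def)
        then have "l \<le> t" "t \<le> l + 2" using pending' by fastforce+
        with t(1) r have "r < l" by (auto simp: run_def)
        with run'[OF t(1)] \<open>l \<le> t\<close> have "run s r t" "t = l" by auto
        then have "run s r l" by blast
        then have "exposed s r" using \<open>source s l\<close> by (auto simp: exposed_def)
        moreover have "\<not> exposed s' r"
        proof
          assume "exposed s' r"
          then obtain t where t: "run s' r t" "source s' t" by (auto simp: exposed_def)
          then have "t < l" using run'[OF t(1)] \<open>r < l\<close> nsource by (cases "t = l") auto
          then have "loose s t"
            using source'[of t] t r by (auto simp: source_def run_def clean)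
          moreover have "barred s t"
            using \<open>run s r l\<close> t(1) \<open>t < l\<close> by (auto simp: run_def)
          ultimately show False by (simp add: loose_def barred_def)
        qed
        ultimately show ?thesis
          using sweep_cost_le[of s' r] by (simp add: cost_def)
      qed
    qed
  qed
  then show ?thesis by (simp add: s'_def)
qed

section \<open>Rank and length of the path\<close>

text \<open>A lexicographic measure as one number: the factor exceeds every potential, so a new
  monochromatic cycle outweighs any rise of the potential.\<close>

definition rank :: "('v \<Rightarrow> 'c) \<Rightarrow> nat" where
  "rank s = (m - mono_count s) * Suc (9 * n * m\<^sup>2) + potential s"

lemma rank_less_mono_count:
  assumes "mono_count s < mono_count s'"
  shows "rank s' < rank s"
proof -
  have "Suc (m - mono_count s') \<le> m - mono_count s"
    using assms mono_count_le[of s'] by linarith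
  from mult_le_mono1[OF this, of "Suc (9 * n * m\<^sup>2)"] show ?thesis
    using potential_le[of s'] by (simp add: rank_def)
qed

lemma rank_less_potential:
  assumes "improvement_step s s'" "potential s' < potential s"
  shows "rank s' < rank s"
  using mono_count_mono[OF assms(1)] assms(2) unfolding rank_def
  by (intro add_le_less_mono mult_le_mono1) auto

text \<open>Pending nodes move first, then loose links without support from above. If neither
  exists, the strategy is a Nash equilibrium, and the given deviation itself creates a monochromatic
  cycle.\<close>

lemma improvement_step_rank:
  assumes "improvement_step s t"
  obtains s' where "improvement_step s s'" "rank s' < rank s"
proof -
  have s: "s \<in> joint_strategies"
    using assms by (auto simp: improvement_step_def profitable_deviation_def)
  consider (pending) "\<exists>q i. pending s q i"
    | (loose) "\<And>q i. \<not> pending s q i" "\<exists>l. 1 \<le> l \<and> l \<le> m \<and> loose s l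
        \<and> (l < m \<longrightarrow> col s (Suc l) (k l - 1) \<noteq> col s l 1)"
    | (stable) "\<And>q i. \<not> pending s q i" "\<And>l. 1 \<le> l \<Longrightarrow> l \<le> m \<Longrightarrow> loose s l \<Longrightarrow>
        l < m \<and> col s (Suc l) (k l - 1) = col s l 1"
    by blast
  then show thesis
  proof cases
    case pending
    define Q where "Q = {q. \<exists>i. pending s q i}"
    have fin: "finite Q" by (rule finite_subset[of _ "{..m}"]) (auto simp: Q_def pending_def)
    then have "Max Q \<in> Q" using pending by (intro Max_in) (auto simp: Q_def)
    then have ex: "\<exists>i. pending s (Max Q) i" by (simp add: Q_def)
    define i where "i = (LEAST i. pending s (Max Q) i)"
    have p: "pending s (Max Q) i" unfolding i_def by (rule LeastI_ex[OF ex])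
    have "topmost s (Max Q)"
      using Max_ge[OF fin] by (force simp: topmost_def Q_def not_le[symmetric])
    then have "mono_cycle (s(node (Max Q, i) := col s (Max Q) (i - 1))) (Max Q) \<and> \<not> mono_cycle s (Max Q)
        \<or> potential (s(node (Max Q, i) := col s (Max Q) (i - 1))) < potential s"
      by (intro follow_progress[OF s p]) (auto simp: i_def dest: not_less_Least)
    with follow_improves[OF s p] show thesis
      using pending_range[OF p] mono_count_less rank_less_mono_count rank_less_potential that
      by metis
  next
    case loose
    then obtain l where l: "1 \<le> l" "l \<le> m" "loose s l"
      "l < m \<Longrightarrow> col s (Suc l) (k l - 1) \<noteq> col s l 1" by blast
    show thesis
      using that lock_improves[OF s l] rank_less_potential lock_progress[OF loose(1) l(1-3)] by blast
  next
    case stable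
    obtain K where K: "profitable_deviation K s t"
      using assms by (auto simp: improvement_step_def)
    obtain q where "1 \<le> q" "q \<le> m" "mono_cycle t q" "\<not> mono_cycle s q"
      using coalition_deviation_mono_cycle[OF K stable_if_quiet[OF s stable]] by blast
    then show thesis
      using that[OF assms] rank_less_mono_count mono_count_less[OF assms] by blast
  qed
qed

lemma improvement_sequence_Cons:
  assumes "improvement_step s s'" "p \<noteq> []" "hd p = s'"
  shows "improvement_sequence (s # p) \<longleftrightarrow> improvement_sequence p"
  using assms by (cases p)
    (auto simp: improvement_sequence_def improvement_step_def profitable_deviation_def)

lemma finite_path_rank:
  assumes "s \<in> joint_strategies"
  shows "\<exists>p. finite_c_improvement_path p \<and> hd p = s \<and> length p \<le> Suc (rank s)"
  using assms
proof (induction "rank s" arbitrary: s rule: less_induct)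
  case less
  show ?case
  proof (cases "\<exists>t. improvement_step s t")
    case False
    then have "finite_c_improvement_path [s]"
      using less.prems by (auto simp: finite_c_improvement_path_def improvement_sequence_def)
    then show ?thesis by (intro exI[of _ "[s]"]) auto
  next
    case True
    then obtain s' where s': "improvement_step s s'" "rank s' < rank s"
      using improvement_step_rank by blast
    then have "s' \<in> joint_strategies"
      by (auto simp: improvement_step_def profitable_deviation_def)
    from less.hyps[OF s'(2) this] obtain p where
      p: "finite_c_improvement_path p" "hd p = s'" "length p \<le> Suc (rank s')" by blast
    then have "p \<noteq> []" by (auto simp: finite_c_improvement_path_def improvement_sequence_def)
    with p s'(1) have "finite_c_improvement_path (s # p)"
      using improvement_sequence_Cons[of s s' p] improvement_sequence_Cons[of s s' "p @ [t]" for t]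
      by (auto simp: finite_c_improvement_path_def)
    with p(3) s'(2) show ?thesis by (intro exI[of _ "s # p"]) auto
  qed
qed

text \<open>The three summands, with the successor joined to \<open>m\<close>, give
  \<open>9 + 1 + 9\<close> copies of \<open>n * m ^ 3\<close>; \<open>20\<close> is a round
  bound.\<close>

lemma rank_le: "Suc (rank s) \<le> 20 * n * m ^ 3"
proof -
  have "rank s \<le> m * Suc (9 * n * m\<^sup>2) + 9 * n * m\<^sup>2"
    unfolding rank_def using potential_le by (intro add_mono mult_le_mono1) auto
  also have "\<dots> = 9 * (n * m ^ 3) + m + 9 * (n * m\<^sup>2)"
    by (simp add: power3_eq_cube power2_eq_square algebra_simps)
  finally have "rank s \<le> 9 * (n * m ^ 3) + m + 9 * (n * m\<^sup>2)" .
  moreover have "n * m\<^sup>2 \<le> n * m ^ 3"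
    using m_ge by (intro mult_le_mono2 power_increasing) auto
  moreover have "m < n * m ^ 3"
  proof -
    have "m \<le> m ^ 3" using m_ge by (intro self_le_power) auto
    moreover have "1 * m ^ 3 < n * m ^ 3" using m_ge n_ge by (intro mult_strict_right_mono) auto
    ultimately show ?thesis by linarith
  qed
  ultimately show ?thesis unfolding mult.assoc by linarith
qed

end

lemma open_chain_of_cyclesE:
  assumes "open_chain_of_cycles m n G" "coordination_game G M C" "2 \<le> m" "3 \<le> n"
  obtains k node where "open_chain G M C m n k node"
proof -
  from assms(1) obtain k node where *: "\<forall>j\<in>{1..m - 1}. k j \<in> {2..n}"
    "pverts G = node ` chain_labels m n"
    "parcs G = {(node (j, i), node (j, i mod n + 1)) | j i. (j, i) \<in> chain_labels m n}"
    "\<forall>x\<in>chain_labels m n. \<forall>y\<in>chain_labels m n. node x = node y \<longleftrightarrow>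
      (x, y) \<in> (chain_identifications m k \<union> (chain_identifications m k)\<inverse>)\<^sup>*"
    unfolding open_chain_of_cycles_def by (elim exE conjE)
  show thesis
    by (rule that, rule open_chain.intro[OF assms(2) open_chain_axioms.intro]) (fact assms(3,4) *)+
qed

(* Neither 'v nor 'c weakens the absoluteness of A: every game considered is finite, hence
   isomorphic to one with 'v = 'c = nat, so the A of that single instance serves all games. *)
theorem corollary16:
  shows "\<exists>A :: nat. \<forall>(m :: nat) (n :: nat) (G :: 'v pair_pre_digraph) (M :: 'c set)
            (C :: 'v \<Rightarrow> 'c set) (s :: 'v \<Rightarrow> 'c).
           m \<ge> 2 \<longrightarrow> n \<ge> 3 \<longrightarrow> open_chain_of_cycles m n G \<longrightarrow> coordination_game G M C \<longrightarrow>
           s \<in> coordination_game.joint_strategies G C \<longrightarrow>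
           (\<exists>p. coordination_game.finite_c_improvement_path G C p \<and> hd p = s \<and>
                length p \<le> A * n * m ^ 3)"
proof (intro exI[of _ 20] allI impI)
  fix m n and G :: "'v pair_pre_digraph" and M :: "'c set" and C and s :: "'v \<Rightarrow> 'c"
  assume "m \<ge> 2" "n \<ge> 3" "open_chain_of_cycles m n G" "coordination_game G M C"
    and s: "s \<in> coordination_game.joint_strategies G C"
  then obtain k node where "open_chain G M C m n k node"
    by (elim open_chain_of_cyclesE)
  then interpret open_chain G M C m n k node .
  show "\<exists>p. finite_c_improvement_path p \<and> hd p = s \<and> length p \<le> 20 * n * m ^ 3"
    using finite_path_rank[OF s] rank_le[of s] order_trans by blast
qed

end
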